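(* Let $(\mathcal{P}^{\text{co}}_{\mathcal{E}_t})_{t\ge 0}$ be the sequence of DIPK belief sets on $(\Omega,\mathcal{F})$ defined in the context, with lower and upper probabilities $\underline{P}_{\mathcal{E}_t},\overline{P}_{\mathcal{E}_t}$. Let $t\in\mathbb{N}$ and $A\in\mathcal{F}$. If there exist $P_{s,\mathcal{E}_t},P_{k,\mathcal{E}_t}\in\mathcal{P}^{\text{co}}_{\mathcal{E}_t}$ such that $\underline{P}_{\mathcal{E}_{t-1}}(A)\ge P_{s,\mathcal{E}_t}(A)$ and $\overline{P}_{\mathcal{E}_{t-1}}(A)\le P_{k,\mathcal{E}_t}(A)$, and at least one of these inequalities is strict, then $\mathcal{P}^{\text{co}}_{\mathcal{E}_t}$ DIPK-dilates with respect to $\mathcal{P}^{\text{co}}_{\mathcal{E}_{t-1}}$ for $A$.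
   Context: $\Omega$ is at most countable, $\mathcal{F}=2^\Omega$, $\Delta(\Omega,\mathcal{F})$ is the set of probability measures on $(\Omega,\mathcal{F})$, $X:\Omega\to\mathcal{X}$ is a function, $(x_i)_{i\ge1}$ is a sequence of data points in $X(\Omega)$, $0=n_0<n_1<n_2<\cdots$ are integers, $\beta$ takes values in $[0,1]$, $\mathbb{N}=\{1,2,\dots\}$. DPK update of a measure. At time $t\ge 1$ the data $x_1,\dots,x_{n_t}$ are available. Let $E_1,\dots,E_m$ be the distinct sets among $X^{-1}(x_1),\dots,X^{-1}(x_{n_t})$, $E_{m+1}=\Omega\setminus\bigcup_{j=1}^m E_j$, and $\mathcal{E}_t=\{E_1,\dots,E_{m+1}\}$. If $E_{m+1}\ne\emptyset$, $P^{emp}_t(E_j)=\frac{1}{n_t+1}\#\{i\le n_t: X^{-1}(x_i)=E_j\}$ for $j\le m$ and $P^{emp}_t(E_{m+1})=1-\sum_{j=1}^m P^{emp}_t(E_j)$; if $E_{m+1}=\emptyset$, $P^{emp}_t(E_j)=\frac{1}{n_t}\#\{i\le n_t: X^{-1}(x_i)=E_j\}$ for $j\le m$ and $P^{emp}_t(E_{m+1})=0$. The time-$t$ DPK update of $P_{\mathcal{E}_{t-1}}\in\Delta(\Omega,\mathcal{F})$ is $P_{\mathcal{E}_t}(A)=\sum_{E_j\in\mathcal{E}_t}P_{\mathcal{E}_{t-1}}(A\mid E_j)P_{\mathcal{E}_t}(E_j)$, $A\in\mathcal{F}$, with $P_{\mathcal{E}_t}(E_j)=\beta(n_t)P_{\mathcal{E}_{t-1}}(E_j)+[1-\beta(n_t)]P^{emp}_t(E_j)$.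 Terms with $E_j=\emptyset$ are $0$ in all sums. DIPK. The agent specifies a set $\mathcal{P}\subset\Delta(\Omega,\mathcal{F})$ with lower probability $\underline{P}(A)=\inf_{P\in\mathcal{P}}P(A)$. The initial belief set is $\mathcal{P}^{\text{co}}_{\mathcal{E}_0}=\text{core}(\underline{P})=\{P\in\Delta(\Omega,\mathcal{F}):P(A)\ge\underline{P}(A)\ \forall A\in\mathcal{F}\}$, and $\mathcal{P}_{\mathcal{E}_0}$ is its set of extreme points, assumed finite, with $\mathcal{P}^{\text{co}}_{\mathcal{E}_0}=\text{Conv}(\mathcal{P}_{\mathcal{E}_0})$ and with every $P\in\mathcal{P}_{\mathcal{E}_0}$ positive on all nonempty events. For $t\ge1$, $\mathcal{P}_{\mathcal{E}_t}$ is the set of time-$t$ DPK updates of the elements of $\mathcal{P}_{\mathcal{E}_{t-1}}$, and $\mathcal{P}^{\text{co}}_{\mathcal{E}_t}=\text{Conv}(\mathcal{P}_{\mathcal{E}_t})$ (convex hull). Put $\underline{P}_{\mathcal{E}_t}(A)=\inf_{P\in\mathcal{P}^{\text{co}}_{\mathcal{E}_t}}P(A)$ and $\overline{P}_{\mathcal{E}_t}(A)=\sup_{P\in\mathcal{P}^{\text{co}}_{\mathcal{E}_t}}P(A)=1-\underline{P}_{\mathcal{E}_t}(A^c)$. $\mathcal{P}^{\text{co}}_{\mathcal{E}_t}$ DIPK-dilates with respect to $\mathcal{P}^{\text{co}}_{\mathcal{E}_{t-1}}$ for $A$ if $\underline{P}_{\mathcal{E}_t}(A)\le\underline{P}_{\mathcal{E}_{t-1}}(A)$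 and $\overline{P}_{\mathcal{E}_t}(A)\ge\overline{P}_{\mathcal{E}_{t-1}}(A)$, with at least one inequality strict. *)

theory Defs
  imports "HOL-Probability.Probability" "HOL-Library.Function_Algebras"
begin

text \<open>
  The sample space is a whole type of class \<open>countable\<close>, and every subset of it is an event.
  A probability measure is identified with its set function \<open>'a set \<Rightarrow> real\<close>. Set functions form
  a real vector space under the pointwise operations, so \<open>convex hull\<close> and \<open>extreme_point_of\<close>
  apply to sets of probability measures.
\<close>

instantiation "fun" :: (type, real_vector) real_vector
begin

definition scaleR_fun :: "real \<Rightarrow> ('a \<Rightarrow> 'b) \<Rightarrow> 'a \<Rightarrow> 'b" where
  "scaleR_fun c f = (\<lambda>x. c *\<^sub>R f x)"

instance
  by standard (simp_all add: scaleR_fun_def fun_eq_iff scaleR_add_left scaleR_add_right)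

end

definition prob_measures :: "('a::countable set \<Rightarrow> real) set" where
  "prob_measures = {measure M | M. prob_space M \<and> space M = UNIV \<and> sets M = UNIV}"

definition lower_prob :: "('a set \<Rightarrow> real) set \<Rightarrow> 'a set \<Rightarrow> real" where
  "lower_prob C A = (INF P\<in>C. P A)"

definition upper_prob :: "('a set \<Rightarrow> real) set \<Rightarrow> 'a set \<Rightarrow> real" where
  "upper_prob C A = (SUP P\<in>C. P A)"

definition core :: "('a::countable set \<Rightarrow> real) \<Rightarrow> ('a set \<Rightarrow> real) set" where
  "core L = {P \<in> prob_measures. \<forall>A. P A \<ge> L A}"

definition cond_prob_of :: "('a set \<Rightarrow> real) \<Rightarrow> 'a set \<Rightarrow> 'a set \<Rightarrow> real" where
  "cond_prob_of P A E = P (A \<inter> E) / P E"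

text \<open>
  In the following, \<open>N\<close> is the number of data points \<open>x 1, \<dots>, x N\<close> available; the value \<open>x 0\<close>
  is never used. The set \<open>observed_events X x N\<close> is \<open>{E\<^sub>1, \<dots>, E\<^sub>m}\<close>, and the residual event is
  \<open>E\<^sub>m\<^sub>+\<^sub>1\<close>.
\<close>

definition observed_events :: "('a \<Rightarrow> 'b) \<Rightarrow> (nat \<Rightarrow> 'b) \<Rightarrow> nat \<Rightarrow> 'a set set" where
  "observed_events X x N = (\<lambda>i. X -` {x i}) ` {1..N}"

definition residual_event :: "('a \<Rightarrow> 'b) \<Rightarrow> (nat \<Rightarrow> 'b) \<Rightarrow> nat \<Rightarrow> 'a set" where
  "residual_event X x N = UNIV - \<Union>(observed_events X x N)"

definition data_partition :: "('a \<Rightarrow> 'b) \<Rightarrow> (nat \<Rightarrow> 'b) \<Rightarrow> nat \<Rightarrow> 'a set set" where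
  "data_partition X x N = insert (residual_event X x N) (observed_events X x N)"

definition data_count :: "('a \<Rightarrow> 'b) \<Rightarrow> (nat \<Rightarrow> 'b) \<Rightarrow> nat \<Rightarrow> 'a set \<Rightarrow> nat" where
  "data_count X x N E = card {i \<in> {1..N}. X -` {x i} = E}"

text \<open>Only the values of \<open>emp_prob X x N\<close> on \<open>data_partition X x N\<close> are meaningful.\<close>

definition emp_prob :: "('a \<Rightarrow> 'b) \<Rightarrow> (nat \<Rightarrow> 'b) \<Rightarrow> nat \<Rightarrow> 'a set \<Rightarrow> real" where
  "emp_prob X x N E =
     (if residual_event X x N \<noteq> {} then
        (if E = residual_event X x N
         then 1 - (\<Sum>F\<in>observed_events X x N. real (data_count X x N F) / (real N + 1))
         else real (data_count X x N E) / (real N + 1))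
      else
        (if E = residual_event X x N then 0
         else real (data_count X x N E) / real N))"

definition dpk_weight ::
  "('a \<Rightarrow> 'b) \<Rightarrow> (nat \<Rightarrow> 'b) \<Rightarrow> (nat \<Rightarrow> real) \<Rightarrow> nat \<Rightarrow> ('a set \<Rightarrow> real) \<Rightarrow> 'a set \<Rightarrow> real" where
  "dpk_weight X x \<beta> N P E = \<beta> N * P E + (1 - \<beta> N) * emp_prob X x N E"

definition dpk_update ::
  "('a \<Rightarrow> 'b) \<Rightarrow> (nat \<Rightarrow> 'b) \<Rightarrow> (nat \<Rightarrow> real) \<Rightarrow> nat \<Rightarrow> ('a set \<Rightarrow> real) \<Rightarrow> 'a set \<Rightarrow> real" where
  "dpk_update X x \<beta> N P A =
     (\<Sum>E\<in>data_partition X x N.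
        if E = {} then 0 else cond_prob_of P A E * dpk_weight X x \<beta> N P E)"

text \<open>
  Here \<open>n t\<close> is the number of data points available at time \<open>t\<close>, and \<open>\<P>\<close> is the set of
  probability measures that the agent specifies.
\<close>

primrec dipk_generators ::
  "('a::countable \<Rightarrow> 'b) \<Rightarrow> (nat \<Rightarrow> 'b) \<Rightarrow> (nat \<Rightarrow> nat) \<Rightarrow> (nat \<Rightarrow> real) \<Rightarrow> ('a set \<Rightarrow> real) set
     \<Rightarrow> nat \<Rightarrow> ('a set \<Rightarrow> real) set" where
  "dipk_generators X x n \<beta> \<P> 0 = {P. P extreme_point_of core (lower_prob \<P>)}"
| "dipk_generators X x n \<beta> \<P> (Suc t) =
     dpk_update X x \<beta> (n (Suc t)) ` dipk_generators X x n \<beta> \<P> t"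

definition dipk_belief ::
  "('a::countable \<Rightarrow> 'b) \<Rightarrow> (nat \<Rightarrow> 'b) \<Rightarrow> (nat \<Rightarrow> nat) \<Rightarrow> (nat \<Rightarrow> real) \<Rightarrow> ('a set \<Rightarrow> real) set
     \<Rightarrow> nat \<Rightarrow> ('a set \<Rightarrow> real) set" where
  "dipk_belief X x n \<beta> \<P> t =
     (if t = 0 then core (lower_prob \<P>) else convex hull (dipk_generators X x n \<beta> \<P> t))"

definition dipk_dilates ::
  "('a set \<Rightarrow> real) set \<Rightarrow> ('a set \<Rightarrow> real) set \<Rightarrow> 'a set \<Rightarrow> bool" where
  "dipk_dilates C' C A \<longleftrightarrow>
     lower_prob C' A \<le> lower_prob C A \<and> upper_prob C' A \<ge> upper_prob C A \<and>
     (lower_prob C' A < lower_prob C A \<or> upper_prob C' A > upper_prob C A)"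

end

theory Submission
  imports Defs
begin

text \<open>
  A member of a set of set functions bounds the lower probability of that set from above and its
  upper probability from below, so a witness pair for the two comparisons already gives dilation.
  The only thing to check is that the infimum and the supremum over the new belief set are
  genuine bounds, that is, that the values at the event form a bounded set of reals. They do
  because a DIPK belief set at a positive time is the convex hull of finitely many generators:
  the finite set of extreme points at time 0 is mapped forward by one update per step, and
  evaluation at an event, being linear, sends the hull of the generators onto the hull of
  finitely many reals.
\<close>

lemma linear_eval_at: "linear (\<lambda>P :: 'a \<Rightarrow> 'b::real_vector. P a)"
  by (rule linearI) (simp_all add: scaleR_fun_def)

lemma bounded_eval_convex_hull_finite:
  fixes G :: "('a \<Rightarrow> real) set"
  assumes "finite G"
  shows "bounded ((\<lambda>P. P a) ` (convex hull G))"
  using assms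
  by (simp add: convex_hull_linear_image[OF linear_eval_at] finite_imp_bounded_convex_hull)

lemma finite_dipk_generators:
  assumes "finite (dipk_generators X x n \<beta> \<P> 0)"
  shows "finite (dipk_generators X x n \<beta> \<P> t)"
  using assms by (induction t) auto

lemma bounded_eval_dipk_belief:
  assumes "finite (dipk_generators X x n \<beta> \<P> 0)" and "t \<ge> 1"
  shows "bounded ((\<lambda>P. P A) ` dipk_belief X x n \<beta> \<P> t)"
  using assms
  by (simp add: dipk_belief_def bounded_eval_convex_hull_finite finite_dipk_generators)

text \<open>
  Boundedness matters: an infimum or supremum of an unbounded set of reals carries an
  unspecified value, which need not bound the set.
\<close>

lemma dipk_dilates_if_witnesses:
  assumes bounded: "bounded ((\<lambda>P. P A) ` C')"
    and witnesses: "Ps \<in> C'" "Pk \<in> C'"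
    and le: "Ps A \<le> lower_prob C A" "upper_prob C A \<le> Pk A"
    and strict: "Ps A < lower_prob C A \<or> upper_prob C A < Pk A"
  shows "dipk_dilates C' C A"
proof -
  have "lower_prob C' A \<le> Ps A"
    unfolding lower_prob_def
    using bounded_imp_bdd_below[OF bounded] witnesses(1) by (rule cINF_lower)
  moreover have "Pk A \<le> upper_prob C' A"
    unfolding upper_prob_def
    using witnesses(2) bounded_imp_bdd_above[OF bounded] by (rule cSUP_upper)
  ultimately show ?thesis
    using le strict unfolding dipk_dilates_def by linarith
qed

theorem proposition23:
  fixes X :: "'a::countable \<Rightarrow> 'b"
    and x :: "nat \<Rightarrow> 'b"
    and n :: "nat \<Rightarrow> nat"
    and \<beta> :: "nat \<Rightarrow> real"
    and \<P> :: "('a set \<Rightarrow> real) set"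
    and t :: nat
    and A :: "'a set"
  assumes "\<And>i. i \<ge> 1 \<Longrightarrow> x i \<in> range X"
    and "n 0 = 0" and "strict_mono n"
    and "\<And>k. k \<ge> 1 \<Longrightarrow> 0 \<le> \<beta> k \<and> \<beta> k \<le> 1"
    and "\<P> \<subseteq> prob_measures"
    and "finite (dipk_generators X x n \<beta> \<P> 0)"
    and "dipk_belief X x n \<beta> \<P> 0 = convex hull (dipk_generators X x n \<beta> \<P> 0)"
    and "\<And>P B. P \<in> dipk_generators X x n \<beta> \<P> 0 \<Longrightarrow> B \<noteq> {} \<Longrightarrow> P B > 0"
    and "t \<ge> 1"
    and "\<exists>Ps \<in> dipk_belief X x n \<beta> \<P> t. \<exists>Pk \<in> dipk_belief X x n \<beta> \<P> t.
           lower_prob (dipk_belief X x n \<beta> \<P> (t - 1)) A \<ge> Ps A \<and>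
           upper_prob (dipk_belief X x n \<beta> \<P> (t - 1)) A \<le> Pk A \<and>
           (lower_prob (dipk_belief X x n \<beta> \<P> (t - 1)) A > Ps A \<or>
            upper_prob (dipk_belief X x n \<beta> \<P> (t - 1)) A < Pk A)"
  shows "dipk_dilates (dipk_belief X x n \<beta> \<P> t) (dipk_belief X x n \<beta> \<P> (t - 1)) A"
  using assms(10) bounded_eval_dipk_belief[OF assms(6) assms(9)]
  by (blast intro: dipk_dilates_if_witnesses)

end
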